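(* Let $(a,b,c)$ be a primitive Pythagorean triple and let $E$ be the elliptic curve over $\mathbb{Q}$ given by $y^2=x(x-a^2)(x-b^2)$. Then $E(\mathbb{Q})$ has no point of order $4$.
   Context: A primitive Pythagorean triple is a triple $(a,b,c)$ of positive integers with no common divisor satisfying $a^2+b^2=c^2$. $E(\mathbb{Q})$ denotes the group of rational points of $E$ together with the point at infinity $O$. *)

theory Defs
  imports "HOL-Algebra.Multiplicative_Group" "HOL-Computational_Algebra.Polynomial"
begin

definition primitive_pythagorean_triple :: "int \<Rightarrow> int \<Rightarrow> int \<Rightarrow> bool" where
  "primitive_pythagorean_triple a b c \<longleftrightarrow>
     a > 0 \<and> b > 0 \<and> c > 0 \<and> Gcd {a, b, c} = 1 \<and> a\<^sup>2 + b\<^sup>2 = c\<^sup>2"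

datatype 'a ec_point = Infinity | Point 'a 'a

text \<open>
  A monic cubic \<open>f\<close> represents the curve \<open>y\<^sup>2 = f(x)\<close>; it is an elliptic curve if the
  characteristic is not 2 and \<open>f\<close> has no repeated root.
\<close>

definition ec_points :: "'a::field poly \<Rightarrow> 'a ec_point set" where
  "ec_points f = insert Infinity {Point x y | x y. y\<^sup>2 = poly f x}"

text \<open>
  Chord-tangent addition. The line of slope \<open>l\<close> through the two points meets the curve
  in three points whose \<open>x\<close>-coordinates sum to \<open>l\<^sup>2 - coeff f 2\<close>; the sum is the
  reflection of the third one in the \<open>x\<close>-axis. In the tangent case \<open>x\<^sub>1 = x\<^sub>2\<close> the
  points coincide, because \<open>y\<^sub>2 = \<plusminus>y\<^sub>1\<close> for points on the curve.
\<close>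

fun ec_add :: "'a::field poly \<Rightarrow> 'a ec_point \<Rightarrow> 'a ec_point \<Rightarrow> 'a ec_point" where
  "ec_add f Infinity Q = Q"
| "ec_add f P Infinity = P"
| "ec_add f (Point x\<^sub>1 y\<^sub>1) (Point x\<^sub>2 y\<^sub>2) =
     (if x\<^sub>1 = x\<^sub>2 \<and> y\<^sub>1 = - y\<^sub>2 then Infinity
      else let l = (if x\<^sub>1 = x\<^sub>2 then poly (pderiv f) x\<^sub>1 / (2 * y\<^sub>1)
                    else (y\<^sub>2 - y\<^sub>1) / (x\<^sub>2 - x\<^sub>1));
               x\<^sub>3 = l\<^sup>2 - coeff f 2 - x\<^sub>1 - x\<^sub>2
           in Point x\<^sub>3 (l * (x\<^sub>1 - x\<^sub>3) - y\<^sub>1))"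

definition ec_group :: "'a::field poly \<Rightarrow> 'a ec_point monoid" where
  "ec_group f = \<lparr>carrier = ec_points f, monoid.mult = ec_add f, one = Infinity\<rparr>"

definition has_order :: "('a, 'b) monoid_scheme \<Rightarrow> 'a \<Rightarrow> nat \<Rightarrow> bool" where
  "has_order G x n \<longleftrightarrow>
     n > 0 \<and> x [^]\<^bsub>G\<^esub> n = \<one>\<^bsub>G\<^esub> \<and> (\<forall>m. 0 < m \<and> m < n \<longrightarrow> x [^]\<^bsub>G\<^esub> m \<noteq> \<one>\<^bsub>G\<^esub>)"

lemma (in group) has_order_iff_ord:
  assumes "x \<in> carrier G"
  shows "has_order G x n \<longleftrightarrow> n > 0 \<and> ord x = n"
proof -
  have "x [^] m = \<one> \<longleftrightarrow> ord x dvd m" for m :: nat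
    using pow_eq_id[OF assms] by blast
  then show ?thesis
    unfolding has_order_def
    by (metis dvd_imp_le dvd_pos_nat dvd_refl le_neq_implies_less linorder_not_less)
qed

lemma monic_cubic_decompose:
  fixes f :: "'a::field poly"
  assumes "degree f = 3" "lead_coeff f = 1"
  obtains p q r where "f = [:r, q, p, 1:]" "coeff f 2 = p"
proof
  show "f = [:coeff f 0, coeff f 1, coeff f 2, 1:]"
  proof (rule poly_eqI)
    fix n :: nat
    consider "n = 0" | "n = 1" | "n = 2" | "n = 3" | "n > 3" by linarith
    then show "coeff f n = coeff [:coeff f 0, coeff f 1, coeff f 2, 1:] n"
      using assms by cases (auto simp: coeff_pCons coeff_eq_0 numeral_eq_Suc split: nat.split)
  qed
qed simp

lemma ec_add_closed:
  fixes f :: "'a::field_char_0 poly"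
  assumes f: "degree f = 3" "lead_coeff f = 1"
    and P: "P \<in> ec_points f" and Q: "Q \<in> ec_points f"
  shows "ec_add f P Q \<in> ec_points f"
proof (cases "P = Infinity \<or> Q = Infinity")
  case True
  then show ?thesis using P Q by (cases P; cases Q) auto
next
  case False
  obtain p q r where pqr: "f = [:r, q, p, 1:]" "coeff f 2 = p"
    using monic_cubic_decompose[OF f] .
  from False obtain x1 y1 x2 y2 where PQ: "P = Point x1 y1" "Q = Point x2 y2"
    by (cases P; cases Q) auto
  have mem: "Point x y \<in> ec_points f \<longleftrightarrow> y\<^sup>2 = x^3 + p * x\<^sup>2 + q * x + r" for x y
    unfolding ec_points_def pqr(1) by (simp add: algebra_simps power2_eq_square power3_eq_cube)
  have e1: "y1\<^sup>2 = x1^3 + p * x1\<^sup>2 + q * x1 + r"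
    and e2: "y2\<^sup>2 = x2^3 + p * x2\<^sup>2 + q * x2 + r"
    using P Q PQ mem by auto
  have fin: "Point x3 (l * (x1 - x3) - y1) \<in> ec_points f"
    if "(l * (x1 - x3) - y1)\<^sup>2 = x3^3 + p * x3\<^sup>2 + q * x3 + r" for l x3
    using that mem by blast
  show ?thesis
  proof (cases "x1 = x2")
    case True
    show ?thesis
    proof (cases "y1 = - y2")
      case True
      then show ?thesis using \<open>x1 = x2\<close> PQ by (simp add: ec_points_def)
    next
      case False
      have "y1\<^sup>2 = y2\<^sup>2" using e1 e2 True by simp
      then have y: "y2 = y1" using False by (auto simp: power2_eq_iff)
      then have y0: "y1 \<noteq> 0" using False by auto
      define l where "l = poly (pderiv f) x1 / (2 * y1)"
      define x3 where "x3 = l\<^sup>2 - p - x1 - x2"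
      have l: "2 * l * y1 = 3 * x1\<^sup>2 + 2 * p * x1 + q"
        using y0 unfolding l_def pqr(1)
        by (simp add: pderiv_pCons field_simps power2_eq_square)
      have q: "q = 2 * l * y1 - 3 * x1\<^sup>2 - 2 * p * x1"
        using l by (simp add: algebra_simps)
      have r: "r = y1\<^sup>2 - x1^3 - p * x1\<^sup>2 - q * x1"
        using e1 by (simp add: algebra_simps)
      have x3: "x3 = l\<^sup>2 - p - 2 * x1"
        using True by (simp add: x3_def)
      have "(l * (x1 - x3) - y1)\<^sup>2 = x3^3 + p * x3\<^sup>2 + q * x3 + r"
        unfolding r q x3 by (simp add: algebra_simps power2_eq_square power3_eq_cube)
      from fin[OF this] show ?thesis
        using PQ True False pqr(2) by (simp add: Let_def l_def x3_def)
    qed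
  next
    case False
    define l where "l = (y2 - y1) / (x2 - x1)"
    define x3 where "x3 = l\<^sup>2 - p - x1 - x2"
    have l: "l * (x2 - x1) = y2 - y1" using False by (simp add: l_def)
    define d where "d = x2 - x1"
    have x2: "x2 = x1 + d" and y2: "y2 = y1 + l * d"
      using l by (simp_all add: d_def)
    have "d * q = d * (2 * y1 * l + l\<^sup>2 * d - 3 * x1\<^sup>2 - 3 * x1 * d - d\<^sup>2 - p * (2 * x1 + d))"
      using e1 e2 unfolding x2 y2 by (simp add: algebra_simps power2_eq_square power3_eq_cube)
    then have q: "q = 2 * y1 * l + l\<^sup>2 * d - 3 * x1\<^sup>2 - 3 * x1 * d - d\<^sup>2 - p * (2 * x1 + d)"
      using False by (simp add: d_def)
    have r: "r = y1\<^sup>2 - x1^3 - p * x1\<^sup>2 - q * x1"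
      using e1 by (simp add: algebra_simps)
    have "(l * (x1 - x3) - y1)\<^sup>2 = x3^3 + p * x3\<^sup>2 + q * x3 + r"
      unfolding r q x3_def x2 by (simp add: algebra_simps power2_eq_square power3_eq_cube)
    from fin[OF this] show ?thesis
      using PQ False pqr(2) by (simp add: Let_def l_def x3_def)
  qed
qed

end

theory Submission
  imports Defs "HOL-Computational_Algebra.Nth_Powers"
begin

text \<open>
  If \<open>P\<close> has order 4, then \<open>2P = (X, 0)\<close> for a root \<open>X\<close> of the cubic, and the tangent at \<open>P\<close>
  passes through \<open>(X, 0)\<close>. This forces the differences of \<open>X\<close> to the other two roots to be
  rational squares. For \<open>X = 0\<close> a negative number would be a square. For \<open>X = a\<^sup>2\<close> or
  \<open>X = b\<^sup>2\<close> both the sum and the difference of two coprime positive squares would be squares,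
  which Fermat's infinite descent excludes.
\<close>

section \<open>Fermat's infinite descent over the natural numbers\<close>

lemma coprime_mult_eq_powerD:
  fixes m n k l :: nat
  assumes "m * n = k ^ l" "coprime m n"
  obtains r s where "m = r ^ l" "n = s ^ l"
proof -
  have "is_nth_power l (m * n)"
    using assms(1) by (auto simp: is_nth_power_def)
  then have "is_nth_power l m \<and> is_nth_power l n"
    using is_nth_power_mult_coprime_nat_iff[OF assms(2)] by simp
  then show ?thesis using that by (auto simp: is_nth_power_def)
qed

lemma coprimeI_primes:
  fixes a b :: "'a::factorial_semiring_gcd"
  assumes "a \<noteq> 0 \<or> b \<noteq> 0" and "\<And>p. prime p \<Longrightarrow> p dvd a \<Longrightarrow> p dvd b \<Longrightarrow> False"
  shows "coprime a b"
proof (rule ccontr)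
  assume "\<not> coprime a b"
  then have "\<not> is_unit (gcd a b)" by (simp only: is_unit_gcd not_False_eq_True)
  moreover have "gcd a b \<noteq> 0" using assms(1) by simp
  ultimately obtain p where "p dvd gcd a b" "prime p" using prime_divisor_exists by blast
  then show False using assms(2)[of p] by simp
qed

text \<open>Here \<open>u\<close> and \<open>v\<close> are coprime legs of a right triangle whose
  area is the square of \<open>b / 2\<close>. Splitting coprime products into powers three times
  turns it into a pair \<open>(p, q)\<close> whose squares again have a square sum and a square
  difference.\<close>

lemma concordant_descent_step:
  fixes u v a b :: nat
  assumes sq: "u\<^sup>2 + v\<^sup>2 = a\<^sup>2" and prod: "2 * (u * v) = b\<^sup>2"
    and cop: "coprime u v" and ev: "even u" and b: "b > 0"
  obtains p q e f where "p < a" "q > 0" "coprime p q" "p\<^sup>2 + q\<^sup>2 = e\<^sup>2" "q\<^sup>2 + f\<^sup>2 = p\<^sup>2"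
proof -
  from ev obtain w where u: "u = 2 * w" by blast
  have "even b" using prod by (metis dvd_triv_left even_power)
  then obtain b' where b': "b = 2 * b'" by blast
  have "w * v = b'\<^sup>2" using prod by (simp add: u b' power2_eq_square)
  moreover have "coprime w v" using cop by (simp add: u)
  ultimately obtain s r where w: "w = s\<^sup>2" and v: "v = r\<^sup>2"
    by (rule coprime_mult_eq_powerD)
  have s0: "s > 0" using prod b by (cases "s = 0") (auto simp: u w)
  have r_odd: "odd r" using cop by (auto simp: u v)
  have sr: "coprime s r" using \<open>coprime w v\<close> by (simp add: w v)
  \<comment> \<open>From here on \<open>(a - r\<^sup>2) / 2\<close> and \<open>(a + r\<^sup>2) / 2\<close> are coprime with product \<open>s ^ 4\<close>,
    so they are fourth powers \<open>q ^ 4\<close> and \<open>p ^ 4\<close> with \<open>p ^ 4 - q ^ 4 = r\<^sup>2\<close>.\<close>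
  have a_eq: "a\<^sup>2 = 4 * s ^ 4 + (r\<^sup>2)\<^sup>2"
    using sq by (simp add: u w v power_mult_distrib flip: power_mult)
  have a_odd: "odd a"
  proof -
    have "odd (a\<^sup>2)" unfolding a_eq using r_odd by simp
    then show ?thesis by simp
  qed
  have "(r\<^sup>2)\<^sup>2 \<le> a\<^sup>2" using a_eq by simp
  then have "r\<^sup>2 \<le> a" by (rule power2_le_imp_le) simp
  moreover have "even (a - r\<^sup>2)" using a_odd r_odd by simp
  ultimately obtain k where a: "a = r\<^sup>2 + 2 * k"
    by (metis evenE le_add_diff_inverse)
  have kprod: "k * (k + r\<^sup>2) = s ^ 4"
    using a_eq unfolding a by (simp add: power2_eq_square algebra_simps)
  have "coprime k r"
  proof (rule coprimeI_primes)
    fix t :: nat assume t: "prime t" "t dvd k" "t dvd r"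
    then have "t dvd s ^ 4" by (metis kprod dvd_mult2)
    then have "t dvd s" using t(1) prime_dvd_power by blast
    then show False using sr t by (meson coprime_common_divisor not_prime_unit)
  qed (use r_odd in \<open>auto elim: oddE\<close>)
  then have "coprime k (k + r\<^sup>2)"
    by (metis coprime_power_right_iff coprime_iff_gcd_eq_1 gcd_add2)
  with kprod obtain q p where q: "k = q ^ 4" and p: "k + r\<^sup>2 = p ^ 4"
    by (rule coprime_mult_eq_powerD)
  have q0: "q > 0" using kprod s0 q by (cases "q = 0") auto
  have pq: "coprime p q" using \<open>coprime k (k + r\<^sup>2)\<close> unfolding p
    by (simp add: q coprime_commute)
  have rpq: "q ^ 4 + r\<^sup>2 = p ^ 4" using p q by simp
  have "q ^ 4 < p ^ 4" using rpq odd_pos[OF r_odd] zero_less_power[of r 2] by linarith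
  then have qp: "q < p" by (rule power_less_imp_less_base) simp
  then have qp2: "q\<^sup>2 < p\<^sup>2" by (simp add: power_strict_mono)
  have fac: "(p\<^sup>2 + q\<^sup>2) * (p\<^sup>2 - q\<^sup>2) = r\<^sup>2"
  proof -
    obtain h where "p\<^sup>2 = q\<^sup>2 + h"
      using le_Suc_ex[OF less_imp_le[OF qp2]] by blast
    moreover have "p ^ 4 = (p\<^sup>2)\<^sup>2" "q ^ 4 = (q\<^sup>2)\<^sup>2" by (simp_all flip: power_mult)
    ultimately show ?thesis using rpq by (simp add: power2_eq_square algebra_simps)
  qed
  \<comment> \<open>A common prime divides the odd number \<open>r\<close>, so it is not 2; dividing
    the sum \<open>2 * p\<^sup>2\<close> of the factors, it then divides \<open>p\<close> and
    \<open>q\<close>.\<close>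
  have "coprime (p\<^sup>2 + q\<^sup>2) (p\<^sup>2 - q\<^sup>2)"
  proof (rule coprimeI_primes)
    fix t :: nat assume t: "prime t" "t dvd p\<^sup>2 + q\<^sup>2" "t dvd p\<^sup>2 - q\<^sup>2"
    have "t dvd r\<^sup>2" using t(2) fac by (metis dvd_mult2)
    then have "t dvd r" using t(1) prime_dvd_power by blast
    then have "t \<noteq> 2" using r_odd by auto
    have "t dvd (p\<^sup>2 + q\<^sup>2) + (p\<^sup>2 - q\<^sup>2)" by (rule dvd_add[OF t(2,3)])
    moreover have "(p\<^sup>2 + q\<^sup>2) + (p\<^sup>2 - q\<^sup>2) = 2 * p\<^sup>2" using qp2 by simp
    ultimately have "t dvd 2 * p\<^sup>2" by simp
    then have tp2: "t dvd p\<^sup>2" using t(1) \<open>t \<noteq> 2\<close>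
      by (metis prime_dvd_mult_iff primes_dvd_imp_eq two_is_prime_nat)
    then have "t dvd q\<^sup>2" using t(2) dvd_add_right_iff by blast
    then show False using tp2 pq t(1)
      by (meson coprime_common_divisor not_prime_unit prime_dvd_power)
  qed (use qp in auto)
  with fac obtain e f where e: "p\<^sup>2 + q\<^sup>2 = e\<^sup>2" and f: "p\<^sup>2 - q\<^sup>2 = f\<^sup>2"
    by (rule coprime_mult_eq_powerD)
  \<comment> \<open>The descent is strict because \<open>a = p ^ 4 + q ^ 4\<close> with
    \<open>q > 0\<close>.\<close>
  have "p \<le> p ^ 4" by (cases "p = 0") (auto intro: self_le_power)
  then have "p < a" using a p q zero_less_power[OF q0, of 4] by linarith
  then show ?thesis using that[OF _ q0 pq e, of f] f qp2 by simp
qed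

text \<open>Half the sum and half the difference of \<open>c\<close> and \<open>d\<close> are the
  legs of a triangle with hypotenuse \<open>a\<close>, to which the descent step applies. Its output
  has the same shape with a smaller first entry, so strong induction on \<open>a\<close>
  closes.\<close>

lemma no_concordant_squares:
  fixes a b c d :: nat
  assumes "b > 0" "coprime a b" "a\<^sup>2 + b\<^sup>2 = c\<^sup>2" "b\<^sup>2 + d\<^sup>2 = a\<^sup>2"
  shows False
  using assms
proof (induction a arbitrary: b c d rule: less_induct)
  case (less a)
  have cd: "c\<^sup>2 = d\<^sup>2 + 2 * b\<^sup>2" using less.prems by simp
  then have "d\<^sup>2 < c\<^sup>2" using less.prems(1) by simp
  then have "d < c" by (rule power_less_imp_less_base) simp
  have "even c = even d" using arg_cong[OF cd, of even] by simp
  with \<open>d < c\<close> have "even (c - d)" by simp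
  then obtain v where c: "c = d + 2 * v"
    by (metis \<open>d < c\<close> evenE le_add_diff_inverse less_imp_le)
  \<comment> \<open>\<open>u = (c + d) / 2\<close> and \<open>v = (c - d) / 2\<close>\<close>
  define u where "u = d + v"
  have prod: "2 * (u * v) = b\<^sup>2"
    using cd unfolding c u_def by (simp add: power2_eq_square algebra_simps)
  have sq: "u\<^sup>2 + v\<^sup>2 = a\<^sup>2"
    using prod less.prems(4) unfolding u_def by (simp add: power2_eq_square algebra_simps)
  have "coprime u v"
  proof (rule coprimeI_primes)
    fix t :: nat assume t: "prime t" "t dvd u" "t dvd v"
    have "t dvd a\<^sup>2" unfolding sq[symmetric] using t by (simp add: power2_eq_square)
    moreover have "t dvd b\<^sup>2" unfolding prod[symmetric] using t by simp
    ultimately show False using less.prems(2) t(1)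
      by (meson coprime_common_divisor not_prime_unit prime_dvd_power)
  qed (use prod less.prems(1) in auto)
  have "even b" using prod by (metis dvd_triv_left even_power)
  \<comment> \<open>The descent step wants an even first leg; since 4 divides
    \<open>2 * (u * v)\<close>, one of the legs is even, and their roles are symmetric.\<close>
  then have "4 dvd b\<^sup>2" by (auto simp: power2_eq_square elim!: evenE)
  then have "even (u * v)" unfolding prod[symmetric] by presburger
  then consider "even u" | "even v" by auto
  then show False
  proof cases
    case 1
    show False
      using concordant_descent_step[OF sq prod \<open>coprime u v\<close> 1 less.prems(1)] less.IH by metis
  next
    case 2
    have "v\<^sup>2 + u\<^sup>2 = a\<^sup>2" "2 * (v * u) = b\<^sup>2" "coprime v u"
      using sq prod \<open>coprime u v\<close> by (simp_all add: ac_simps)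
    from concordant_descent_step[OF this 2 less.prems(1)] show False
      using less.IH by metis
  qed
qed

section \<open>From natural numbers to rational squares\<close>

lemma rat_square_of_int_imp_int_square:
  fixes x :: rat and n :: int
  assumes "x\<^sup>2 = of_int n"
  obtains d where "n = d\<^sup>2"
proof -
  obtain m k where mk: "quotient_of x = (m, k)" by fastforce
  then have k: "k > 0" and cop: "coprime m k" and x: "x = of_int m / of_int k"
    using quotient_of_denom_pos quotient_of_coprime quotient_of_div by blast+
  have "of_int (m\<^sup>2) = (of_int (n * k\<^sup>2) :: rat)"
    using assms k unfolding x by (simp add: field_simps)
  then have eq: "m\<^sup>2 = n * k\<^sup>2" by (simp only: of_int_eq_iff)
  have "coprime (m\<^sup>2) (k\<^sup>2)" using cop by simp
  moreover have "k\<^sup>2 dvd m\<^sup>2" using eq by simp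
  ultimately have "is_unit (k\<^sup>2)" by (meson coprime_common_divisor dvd_refl)
  then have "k\<^sup>2 = 1" by simp
  then show ?thesis using that[of m] eq by simp
qed

text \<open>A rational root would be the root of an integer square, and absolute values would then
  give natural numbers excluded by the descent. No order between \<open>a\<close> and
  \<open>b\<close> is assumed, so both differences of the nonzero roots of the cubic are
  covered.\<close>

lemma pythagorean_diff_squares_not_rat_square:
  fixes a b c :: int and x :: rat
  assumes "b \<noteq> 0" "coprime a b" "a\<^sup>2 + b\<^sup>2 = c\<^sup>2"
  shows "x\<^sup>2 \<noteq> of_int (a\<^sup>2 - b\<^sup>2)"
proof
  assume "x\<^sup>2 = of_int (a\<^sup>2 - b\<^sup>2)"
  then obtain d where d: "a\<^sup>2 - b\<^sup>2 = d\<^sup>2"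
    by (rule rat_square_of_int_imp_int_square)
  have "int ((nat \<bar>a\<bar>)\<^sup>2 + (nat \<bar>b\<bar>)\<^sup>2) = int ((nat \<bar>c\<bar>)\<^sup>2)"
    "int ((nat \<bar>b\<bar>)\<^sup>2 + (nat \<bar>d\<bar>)\<^sup>2) = int ((nat \<bar>a\<bar>)\<^sup>2)"
    using assms(3) d by simp_all
  then show False
    using no_concordant_squares[of "nat \<bar>b\<bar>" "nat \<bar>a\<bar>" "nat \<bar>c\<bar>" "nat \<bar>d\<bar>"] assms(1,2)
    by (simp only: of_nat_eq_iff) simp
qed

section \<open>Points of order 4 and differences of roots\<close>

lemma order_4_tangent_through_root:
  fixes f :: "'a::field_char_0 poly"
  assumes f: "degree f = 3" "lead_coeff f = 1"
    and P: "P \<in> ec_points f" and ord: "has_order (ec_group f) P 4"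
  obtains x y X where "y\<^sup>2 = poly f x" "y \<noteq> 0" "poly f X = 0" "x \<noteq> X"
    "(y / (x - X))\<^sup>2 = coeff f 2 + 2 * x + X"
proof -
  have pow: "P [^]\<^bsub>ec_group f\<^esub> (1::nat) = P"
    "P [^]\<^bsub>ec_group f\<^esub> (2::nat) = ec_add f P P"
    "P [^]\<^bsub>ec_group f\<^esub> (3::nat) = ec_add f (ec_add f P P) P"
    "P [^]\<^bsub>ec_group f\<^esub> (4::nat) = ec_add f (ec_add f (ec_add f P P) P) P"
    by (simp_all add: ec_group_def nat_pow_def numeral_eq_Suc)
  have one: "\<one>\<^bsub>ec_group f\<^esub> = Infinity" by (simp add: ec_group_def)
  have npow: "P [^]\<^bsub>ec_group f\<^esub> m \<noteq> Infinity" if "0 < m" "m < 4" for m :: nat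
    using ord that unfolding has_order_def one by blast
  have n1: "P \<noteq> Infinity" and n2: "ec_add f P P \<noteq> Infinity"
    and n3: "ec_add f (ec_add f P P) P \<noteq> Infinity"
    using npow[of 1] npow[of 2] npow[of 3] unfolding pow by simp_all
  have n4: "ec_add f (ec_add f (ec_add f P P) P) P = Infinity"
    using ord unfolding has_order_def one pow by blast
  obtain x y where Pxy: "P = Point x y" using n1 by (cases P) auto
  obtain X Y where Q: "ec_add f P P = Point X Y" using n2 by (cases "ec_add f P P") auto
  have y0: "y \<noteq> 0" using n2 Pxy by auto
  define m where "m = poly (pderiv f) x / (2 * y)"
  have "y \<noteq> - y" using y0 by (simp add: eq_neg_iff_add_eq_0 flip: mult_2)
  then have X: "X = m\<^sup>2 - coeff f 2 - 2 * x" and Y: "Y = m * (x - X) - y"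
    using Q Pxy by (auto simp: Let_def m_def)
  have on: "y\<^sup>2 = poly f x" using P Pxy by (simp add: ec_points_def)
  have onQ: "Y\<^sup>2 = poly f X"
    using ec_add_closed[OF f P P] Q by (simp add: ec_points_def)
  \<comment> \<open>Powers nest to the left, so \<open>n4\<close> reads \<open>3P + P = O\<close>;
    as \<open>3P\<close> is affine, it must be the reflection of \<open>P\<close>.\<close>
  have neg: "ec_add f (Point X Y) P = Point x (- y)"
  proof (cases "ec_add f (Point X Y) P")
    case (Point x' y')
    then show ?thesis using n4 unfolding Q by (simp add: Pxy Let_def split: if_splits)
  qed (use n3 Q in simp)
  \<comment> \<open>Otherwise \<open>2P\<close> is \<open>P\<close> or \<open>-P\<close>. The first
    gives \<open>3P = P\<close>, against \<open>3P = -P\<close>; the second gives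
    \<open>3P = O\<close>.\<close>
  have ne: "x \<noteq> X"
  proof
    assume xX: "x = X"
    then have "Y = y \<or> Y = - y" using on onQ by (metis power2_eq_iff)
    then show False
    proof
      assume "Y = y"
      then show False using neg Q Pxy xX \<open>y \<noteq> - y\<close> by simp
    next
      assume "Y = - y"
      then show False using n3 Q Pxy xX by simp
    qed
  qed
  define l where "l = (y - Y) / (x - X)"
  have l2: "l\<^sup>2 - coeff f 2 - X - x = x"
    using neg ne Pxy by (auto simp: Let_def l_def)
  \<comment> \<open>The chord through \<open>P\<close> and \<open>2P\<close> is tangent at \<open>P\<close>, up to the sign of its slope.\<close>
  then have "l\<^sup>2 = m\<^sup>2" using X by (simp add: algebra_simps)
  moreover have lY: "y - Y = l * (x - X)" using ne by (simp add: l_def)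
  have "l \<noteq> - m"
  proof
    \<comment> \<open>The reflected tangent passes through \<open>(X, Y)\<close> and
      \<open>(x, - y)\<close>; with slope \<open>- m\<close> the chord would be that line, forcing
      \<open>y = - y\<close>.\<close>
    assume "l = - m"
    with lY Y have "2 * y = 0" by (simp add: algebra_simps)
    then show False using y0 by simp
  qed
  ultimately have "l = m" by (auto simp: power2_eq_iff)
  \<comment> \<open>The tangent at \<open>P\<close> meets the vertical line over \<open>X\<close> at
    height \<open>- Y\<close> and the chord meets it at \<open>Y\<close>; being the same line, they
    give \<open>Y = - Y\<close>.\<close>
  with lY Y have "Y = (y - Y) - y" by simp
  then have "2 * Y = 0" by simp
  then have Y0: "Y = 0" by simp
  have "(y / (x - X))\<^sup>2 = coeff f 2 + 2 * x + X"
    using l2 by (simp add: l_def Y0 algebra_simps)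
  moreover have "poly f X = 0" using onQ Y0 by simp
  ultimately show ?thesis using that on y0 ne by blast
qed

text \<open>The slope condition says that the line through \<open>(p, 0)\<close> and
  \<open>(x, y)\<close> meets the cubic doubly at \<open>x\<close>. With the root \<open>p\<close>
  moved to the origin, the double abscissa \<open>t\<close> satisfies
  \<open>t\<^sup>2 = (p - q) * (p - r)\<close>, which completes a square and yields the witness
  \<open>(t + (p - q)) / m\<close>.\<close>

lemma root_differences_squares:
  fixes x y p q r :: "'a::field"
  assumes on: "y\<^sup>2 = (x - p) * (x - q) * (x - r)" and "y \<noteq> 0" and "x \<noteq> p"
    and slope: "(y / (x - p))\<^sup>2 = 2 * x - q - r"
  shows "\<exists>z. z\<^sup>2 = p - q"
proof -
  define t m where "t = x - p" and "m = y / (x - p)"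
  have t: "t \<noteq> 0" and m: "m \<noteq> 0" and y: "y = m * t"
    using assms(2,3) by (simp_all add: t_def m_def)
  have m2: "m\<^sup>2 = 2 * t + (p - q) + (p - r)"
    using slope by (simp add: m_def t_def)
  have "t * (m\<^sup>2 * t) = t * ((t + (p - q)) * (t + (p - r)))"
    using on unfolding y by (simp add: t_def power2_eq_square algebra_simps)
  then have "m\<^sup>2 * t = (t + (p - q)) * (t + (p - r))" using t by simp
  then have t2: "t\<^sup>2 = (p - q) * (p - r)"
    unfolding m2 by (simp add: power2_eq_square algebra_simps)
  have "(t + (p - q))\<^sup>2 = t\<^sup>2 + 2 * t * (p - q) + (p - q)\<^sup>2"
    by (simp add: power2_eq_square algebra_simps)
  also have "\<dots> = (p - q) * m\<^sup>2"
    unfolding t2 m2 by (simp add: power2_eq_square algebra_simps)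
  finally have "((t + (p - q)) / m)\<^sup>2 = p - q"
    using m by (simp add: power_divide)
  then show ?thesis by blast
qed

theorem theorem5p2:
  fixes a b c :: int and E :: "rat ec_point monoid"
  assumes "primitive_pythagorean_triple a b c"
    and "E = ec_group ([:0, 1:] * [:- (of_int a)\<^sup>2, 1:] * [:- (of_int b)\<^sup>2, 1:])"
  shows "\<not> (\<exists>P \<in> carrier E. has_order E P 4)"
proof
  define A B :: rat where "A = (of_int a)\<^sup>2" and "B = (of_int b)\<^sup>2"
  define f where "f = [:0, 1:] * [:- A, 1:] * [:- B, 1:]"
  have f: "degree f = 3" "lead_coeff f = 1" and coeff: "coeff f 2 = - A - B"
    and poly: "\<And>z. poly f z = z * (z - A) * (z - B)"
    by (simp_all add: f_def coeff_pCons numeral_eq_Suc algebra_simps)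
  have pos: "a > 0" "b > 0" and pyth: "a\<^sup>2 + b\<^sup>2 = c\<^sup>2" and gcd: "Gcd {a, b, c} = 1"
    using assms(1) by (simp_all add: primitive_pythagorean_triple_def)
  have "coprime a b"
  proof (rule coprimeI_primes)
    fix t :: int assume t: "prime t" "t dvd a" "t dvd b"
    have "t dvd c\<^sup>2" unfolding pyth[symmetric] using t by (simp add: power2_eq_square)
    then have "t dvd c" using t(1) prime_dvd_power by blast
    with t have "t dvd Gcd {a, b, c}" by (auto intro: Gcd_greatest)
    then show False using t(1) unfolding gcd by (meson not_prime_unit)
  qed (use pos in auto)
  assume "\<exists>P \<in> carrier E. has_order E P 4"
  then obtain P where "P \<in> ec_points f" "has_order (ec_group f) P 4"
    by (auto simp: assms(2) ec_group_def f_def A_def B_def)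
  then obtain x y X where xy: "y\<^sup>2 = poly f x" "y \<noteq> 0" "poly f X = 0" "x \<noteq> X"
    "(y / (x - X))\<^sup>2 = coeff f 2 + 2 * x + X"
    using order_4_tangent_through_root[OF f] by blast
  consider "X = 0" | "X = A" | "X = B" using xy(3) poly by auto
  then show False
  proof cases
    case 1
    then obtain z where "z\<^sup>2 = 0 - A"
      using root_differences_squares[of y x 0 A B] xy coeff poly by (auto simp: algebra_simps)
    moreover have "A > 0" using pos by (simp add: A_def)
    ultimately show False using zero_le_power2[of z] by linarith
  next
    case 2
    \<comment> \<open>The difference to the root 0 is \<open>A\<close>, a square already; only the
      difference to \<open>B\<close> can give a contradiction.\<close>
    then obtain z where "z\<^sup>2 = A - B"
      using root_differences_squares[of y x A B 0] xy coeff poly by (auto simp: algebra_simps)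
    then show False
      using pythagorean_diff_squares_not_rat_square[of b a c z] pos pyth \<open>coprime a b\<close>
      by (simp add: A_def B_def)
  next
    case 3
    then obtain z where "z\<^sup>2 = B - A"
      using root_differences_squares[of y x B A 0] xy coeff poly by (auto simp: algebra_simps)
    then show False
      using pythagorean_diff_squares_not_rat_square[of a b c z] pos pyth \<open>coprime a b\<close>
      by (simp add: A_def B_def coprime_commute add.commute)
  qed
qed

end
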